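(* Let $k\ge1$ and let $A$ be a $k\times k$ strictly upper triangular matrix of integers such that $B=I+A+A^2+\cdots+A^{k-1}$ has nonnegative entries. Let $P_A$ be the set of integer sequences $\lambda=(\lambda_1,\ldots,\lambda_k)$ satisfying $\lambda_i\ge\sum_{j=i+1}^kA[i,j]\lambda_j$ for $1\le i\le k$, and for $l,m\ge0$ let $Q_A(l,m,k)$ be the set of $\lambda\in P_A$ with $\lambda_1+\lambda_3+\lambda_5+\cdots=l$ and $\lambda_2+\lambda_4+\lambda_6+\cdots=m$. Then \[\sum_{l,m\ge0}|Q_A(l,m,k)|\,x^ly^m=\prod_{i=1}^k\frac{1}{1-x^{o_i}y^{e_i}},\] where $o_i=\sum_{j\ge1}B[2j-1,i]$ and $e_i=\sum_{j\ge1}B[2j,i]$ (sums over row indices within $1,\ldots,k$).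
   Context: A strictly upper triangular matrix $A$ has $A[i,j]=0$ for $i\ge j$; $I$ is the identity matrix. *)

theory Defs
  imports
    "Jordan_Normal_Form.Matrix"
    "HOL-Computational_Algebra.Formal_Power_Series"
begin

text \<open>
  Matrices and vectors are indexed from 0, so the entry \<open>[i,j]\<close> of a matrix with rows and columns
  numbered \<open>1,\<dots>,k\<close> is \<open>A $$ (i - 1, j - 1)\<close> and \<open>\<lambda>\<^sub>i\<close> is \<open>v $ (i - 1)\<close>. In particular the
  odd-numbered rows and parts are the ones with even index, and conversely.
\<close>

definition strictly_upper_triangular :: "'a::zero mat \<Rightarrow> bool" where
  "strictly_upper_triangular A \<longleftrightarrow>
     (\<forall>i < dim_row A. \<forall>j < dim_col A. j \<le> i \<longrightarrow> A $$ (i, j) = 0)"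

text \<open>
  \<open>I + A + \<dots> + A\<^bsup>k-1\<^esup>\<close>. The sum is taken entrywise because the type of matrices of all
  dimensions is not a monoid, so \<open>sum\<close> is not available on it.
\<close>
definition power_sum_mat :: "nat \<Rightarrow> 'a::semiring_1 mat \<Rightarrow> 'a mat" where
  "power_sum_mat k A = mat k k (\<lambda>(i, j). \<Sum>n<k. (A ^\<^sub>m n) $$ (i, j))"

definition P_seqs :: "nat \<Rightarrow> int mat \<Rightarrow> int vec set" where
  "P_seqs k A =
     {v \<in> carrier_vec k. \<forall>i<k. v $ i \<ge> (\<Sum>j\<in>{i<..<k}. A $$ (i, j) * v $ j)}"

definition Q_seqs :: "int mat \<Rightarrow> nat \<Rightarrow> nat \<Rightarrow> nat \<Rightarrow> int vec set" where
  "Q_seqs A l m k =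
     {v \<in> P_seqs k A. (\<Sum>i | i < k \<and> even i. v $ i) = int l \<and>
                      (\<Sum>i | i < k \<and> odd i. v $ i) = int m}"

text \<open>
  The exponents \<open>o\<^sub>i\<close> and \<open>e\<^sub>i\<close>. The truncation by \<open>nat\<close> is harmless for a matrix with
  nonnegative entries.
\<close>
definition o_exp :: "int mat \<Rightarrow> nat \<Rightarrow> nat" where
  "o_exp B i = nat (\<Sum>j | j < dim_row B \<and> even j. B $$ (j, i))"

definition e_exp :: "int mat \<Rightarrow> nat \<Rightarrow> nat" where
  "e_exp B i = nat (\<Sum>j | j < dim_row B \<and> odd j. B $$ (j, i))"

text \<open>
  Power series in \<open>x\<close> and \<open>y\<close> are power series in \<open>x\<close> whose coefficients are power series in \<open>y\<close>.
  The coefficients are rational, and not integers, because the division of power series is only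
  available over coefficients that have an inverse operation.
\<close>
type_synonym bivariate_fps = "rat fps fps"

definition x_var :: bivariate_fps where
  "x_var = fps_X"

definition y_var :: bivariate_fps where
  "y_var = fps_const fps_X"

text \<open>The series \<open>\<Sum> c l m x\<^sup>l y\<^sup>m\<close>, summed over all \<open>l, m \<ge> 0\<close>.\<close>
definition bivariate_gf :: "(nat \<Rightarrow> nat \<Rightarrow> rat) \<Rightarrow> bivariate_fps" where
  "bivariate_gf c = Abs_fps (\<lambda>l. Abs_fps (\<lambda>m. c l m))"

text \<open>
  Although the coefficient ring \<open>rat fps\<close> is not a field, the division below is the true one:
  the constant coefficient of the denominator is a unit of \<open>rat fps\<close>.
\<close>
lemma bivariate_geometric_inverse:
  assumes "a + b > 0"
  shows "(1 - x_var ^ a * y_var ^ b) * (1 / (1 - x_var ^ a * y_var ^ b)) = 1"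
proof -
  define f :: bivariate_fps where "f = 1 - x_var ^ a * y_var ^ b"
  have eq: "fps_nth f 0 = (if a = 0 then 1 - fps_X ^ b else 1)"
    by (auto simp: f_def x_var_def y_var_def fps_const_power fps_X_power_nth)
  have c: "fps_nth (fps_nth f 0) 0 \<noteq> 0"
    using assms by (auto simp: eq fps_X_power_nth)
  have nz: "fps_nth f 0 \<noteq> 0"
    using c by auto
  have sub: "subdegree f = 0"
    using nz by (simp add: subdegree_eq_0_iff)
  have unit: "fps_nth f 0 * inverse (fps_nth f 0) = 1"
    using c inverse_mult_eq_1'[of "fps_nth f 0"] by simp
  have "f * inverse f = 1"
    unfolding fps_inverse_def[of f] by (rule fps_right_inverse) (use unit in simp)
  moreover have "1 / f = inverse f"
    using sub by (simp add: fps_divide_def)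
  ultimately show ?thesis
    by (simp add: f_def)
qed

end

theory Submission
  imports Defs
begin

text \<open>
  Since \<open>A\<close> is nilpotent, \<open>B\<close> is the inverse of \<open>I - A\<close>, and \<open>\<lambda>\<close> lies in \<open>P_A\<close> exactly when
  \<open>\<mu> = (I - A) \<lambda>\<close> is nonnegative. So \<open>\<mu> \<mapsto> B \<mu>\<close> is a bijection from the nonnegative integer
  vectors onto \<open>P_A\<close>, under which the two statistics become \<open>\<Sum> o\<^sub>i \<mu>\<^sub>i\<close> and \<open>\<Sum> e\<^sub>i \<mu>\<^sub>i\<close>;
  the nonnegative vectors with prescribed values of these sums are counted by the product of
  geometric series.
\<close>

section \<open>Weighted solutions\<close>

text \<open>Vanishing off \<open>I\<close> makes a solution determined by its values on
  \<open>I\<close>, and makes the solutions over \<open>I\<close> exactly those over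
  \<open>insert j I\<close> with \<open>f j = 0\<close> when \<open>j\<close> is not in
  \<open>I\<close>.\<close>

definition weighted_solutions ::
    "'i set \<Rightarrow> ('i \<Rightarrow> nat) \<Rightarrow> ('i \<Rightarrow> nat) \<Rightarrow> nat \<Rightarrow> nat \<Rightarrow> ('i \<Rightarrow> nat) set" where
  "weighted_solutions I a b l m =
     {f. (\<forall>i. i \<notin> I \<longrightarrow> f i = 0) \<and> (\<Sum>i\<in>I. a i * f i) = l \<and> (\<Sum>i\<in>I. b i * f i) = m}"

text \<open>Every combined weight is at least 1, so adding the two equations bounds each value by
  \<open>l + m\<close>.\<close>

lemma finite_weighted_solutions:
  assumes "finite I" "\<And>i. i \<in> I \<Longrightarrow> a i + b i > 0"
  shows "finite (weighted_solutions I a b l m)"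
proof -
  have "f i \<le> l + m" if f: "f \<in> weighted_solutions I a b l m" and i: "i \<in> I" for f i
  proof -
    have "f i \<le> (a i + b i) * f i"
      using assms(2)[OF i] by (cases "a i + b i") auto
    also have "\<dots> \<le> (\<Sum>i\<in>I. (a i + b i) * f i)"
      using assms(1) i by (intro member_le_sum) auto
    also have "\<dots> = l + m"
      using f by (auto simp: weighted_solutions_def sum.distrib algebra_simps)
    finally show ?thesis .
  qed
  then have "weighted_solutions I a b l m
      \<subseteq> {f. \<forall>i. (i \<in> I \<longrightarrow> f i \<in> {..l + m}) \<and> (i \<notin> I \<longrightarrow> f i = 0)}"
    by (auto simp: weighted_solutions_def)
  then show ?thesis
    using finite_set_of_finite_funs[OF assms(1), of "{..l + m}" 0] finite_subset by blast
qed

lemma sum_fun_upd_notin: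
  "j \<notin> I \<Longrightarrow> (\<Sum>i\<in>I. a i * (f(j := c)) i) = (\<Sum>i\<in>I. a i * f i)"
  by (intro sum.cong) auto

text \<open>Split by \<open>f j = 0\<close> or \<open>f j > 0\<close>; in the second case lowering
  \<open>f j\<close> by one is invertible. This is the coefficient form of G' = G + x^a y^b G',
  where G and G' are the series for \<open>I\<close> and \<open>insert j I\<close>.\<close>

lemma card_weighted_solutions_insert:
  assumes "finite I" "j \<notin> I" "\<And>i. i \<in> insert j I \<Longrightarrow> a i + b i > 0"
  shows "card (weighted_solutions (insert j I) a b l m) =
    card (weighted_solutions I a b l m) +
    (if a j \<le> l \<and> b j \<le> m
     then card (weighted_solutions (insert j I) a b (l - a j) (m - b j)) else 0)"
proof -
  let ?S = "weighted_solutions (insert j I) a b"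
  let ?P = "{f \<in> ?S l m. f j > 0}"
  have fin: "finite (?S l m)"
    using assms by (intro finite_weighted_solutions) auto
  have split: "?S l m = weighted_solutions I a b l m \<union> ?P"
  proof (rule Set.set_eqI)
    fix f :: "_ \<Rightarrow> nat"
    have "(\<forall>i. i \<notin> insert j I \<longrightarrow> f i = 0) \<longleftrightarrow> (\<forall>i. i \<notin> I \<longrightarrow> f i = 0)" if "f j = 0"
      using that by (metis insert_iff)
    then show "f \<in> ?S l m \<longleftrightarrow> f \<in> weighted_solutions I a b l m \<union> ?P"
      using assms(1,2) by (cases "f j = 0") (auto simp: weighted_solutions_def)
  qed
  have "card (?S l m) = card (weighted_solutions I a b l m) + card ?P"
    using fin split assms(2)
    by (subst split, intro card_Un_disjoint)
       (auto simp: weighted_solutions_def elim: finite_subset[rotated])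
  moreover have "card ?P = card (?S (l - a j) (m - b j))" if le: "a j \<le> l" "b j \<le> m"
  proof (rule bij_betw_same_card)
    show "bij_betw (\<lambda>f. f(j := f j - 1)) ?P (?S (l - a j) (m - b j))"
    proof (rule bij_betwI[where g = "\<lambda>f. f(j := Suc (f j))"])
      show "(\<lambda>f. f(j := f j - 1)) \<in> ?P \<rightarrow> ?S (l - a j) (m - b j)"
        using assms(1,2)
        by (auto simp: weighted_solutions_def sum_fun_upd_notin diff_mult_distrib2
            simp del: fun_upd_apply)
           (auto simp: algebra_simps)
      show "(\<lambda>f. f(j := Suc (f j))) \<in> ?S (l - a j) (m - b j) \<rightarrow> ?P"
        using assms(1,2) le
        by (auto simp: weighted_solutions_def sum_fun_upd_notin simp del: fun_upd_apply) auto
    qed auto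
  qed
  moreover have "card ?P = 0" if nle: "\<not> (a j \<le> l \<and> b j \<le> m)"
  proof -
    \<comment> \<open>A positive \<open>f j\<close> already contributes at least \<open>a j\<close>
      and \<open>b j\<close> to the two sums.\<close>
    have "a j \<le> l \<and> b j \<le> m" if f: "f \<in> ?P" for f
    proof -
      have "a j \<le> a j * f j" "b j \<le> b j * f j"
        using f by auto
      then show ?thesis
        using f assms(1,2) by (auto simp: weighted_solutions_def intro: trans_le_add1)
    qed
    then have "?P = {}"
      using nle by blast
    then show ?thesis
      by (simp only: card.empty)
  qed
  ultimately show ?thesis by auto
qed

lemma nth_x_power_y_power_mult:
  "fps_nth (fps_nth (x_var ^ a * y_var ^ b * F) l) m =
     (if a \<le> l \<and> b \<le> m then fps_nth (fps_nth F (l - a)) (m - b) else 0)"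
  by (auto simp: x_var_def y_var_def fps_const_power mult.assoc fps_X_power_mult_nth)

lemma bivariate_gf_weighted_solutions:
  assumes "finite I" "\<And>i. i \<in> I \<Longrightarrow> a i + b i > 0"
  shows "bivariate_gf (\<lambda>l m. of_nat (card (weighted_solutions I a b l m))) =
    (\<Prod>i\<in>I. 1 / (1 - x_var ^ a i * y_var ^ b i))"
  using assms
proof (induction I rule: finite_induct)
  case empty
  have "weighted_solutions {} a b l m = (if l = 0 \<and> m = 0 then {\<lambda>_. 0} else {})" for l m
    by (auto simp: weighted_solutions_def)
  then show ?case
    by (auto simp: bivariate_gf_def fps_eq_iff)
next
  case (insert j I)
  let ?G = "\<lambda>I. bivariate_gf (\<lambda>l m. of_nat (card (weighted_solutions I a b l m)))"
  let ?f = "1 - x_var ^ a j * y_var ^ b j"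
  have "?G (insert j I) = ?G I + x_var ^ a j * y_var ^ b j * ?G (insert j I)"
  proof (rule fps_ext, rule fps_ext)
    fix l m
    show "fps_nth (fps_nth (?G (insert j I)) l) m =
      fps_nth (fps_nth (?G I + x_var ^ a j * y_var ^ b j * ?G (insert j I)) l) m"
      using card_weighted_solutions_insert[OF insert.hyps, of a b l m] insert.prems
      by (simp only: fps_add_nth nth_x_power_y_power_mult) (simp add: bivariate_gf_def)
  qed
  then have "?f * ?G (insert j I) = ?G I"
    by (simp add: algebra_simps)
  \<comment> \<open>The coefficient ring is not a field, so \<open>?f\<close> is cancelled through
    its explicit inverse; the positive exponent sum makes it a unit.\<close>
  moreover have "?f * (1 / ?f) = 1"
    using insert.prems by (intro bivariate_geometric_inverse) simp
  ultimately have "?G (insert j I) = 1 / ?f * ?G I"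
    using mult.assoc[of "1 / ?f" ?f "?G (insert j I)"]
    by (simp only: mult.commute[of "1 / ?f" ?f] mult_1_left)
  then show ?case
    using insert by simp
qed

section \<open>The geometric sum of a nilpotent matrix\<close>

text \<open>Each further factor \<open>A\<close> pushes the nonzero entries one more diagonal up.
  Taking \<open>n = k\<close> gives nilpotency, and \<open>j = i\<close> the zero diagonals of the
  positive powers.\<close>

lemma pow_mat_strictly_upper_triangular:
  assumes A: "A \<in> carrier_mat k k" "strictly_upper_triangular A"
  shows "\<lbrakk>i < k; j < k; j < i + n\<rbrakk> \<Longrightarrow> (A ^\<^sub>m n) $$ (i, j) = (0 :: 'a :: semiring_1)"
proof (induction n arbitrary: j)
  case (Suc n)
  \<comment> \<open>If \<open>l < i + n\<close>, the induction hypothesis kills the first factor;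
    otherwise \<open>j \<le> l\<close> and the second factor is 0.\<close>
  have "(A ^\<^sub>m n) $$ (i, l) * A $$ (l, j) = 0" if "l < k" for l
    using Suc that A by (cases "l < i + n") (auto simp: strictly_upper_triangular_def)
  then show ?case
    using Suc.prems A pow_carrier_mat[OF A(1), of n] by (simp add: scalar_prod_def)
qed (use A in auto)

lemma pow_mat_Suc_left:
  assumes "A \<in> carrier_mat k k"
  shows "A ^\<^sub>m Suc n = A * A ^\<^sub>m n"
proof (induction n)
  case (Suc n)
  have "A ^\<^sub>m Suc (Suc n) = A * A ^\<^sub>m n * A"
    using Suc by simp
  also have "\<dots> = A * A ^\<^sub>m Suc n"
    using assoc_mult_mat[OF assms pow_carrier_mat[OF assms] assms] by simp
  finally show ?case .
qed (use assms in simp)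

text \<open>Both \<open>A * B\<close> and \<open>B * A\<close> are the sum of the powers 1 to
  \<open>k\<close>, so subtracting either from \<open>B\<close> telescopes to the power 0 minus the
  power \<open>k\<close>, which is zero. The two orders serve the two directions of the
  bijection.\<close>

lemma
  fixes A :: "'a :: ring_1 mat"
  assumes A: "A \<in> carrier_mat k k" "strictly_upper_triangular A"
  shows one_minus_mult_power_sum_mat: "(1\<^sub>m k - A) * power_sum_mat k A = 1\<^sub>m k"
    and power_sum_mat_mult_one_minus: "power_sum_mat k A * (1\<^sub>m k - A) = 1\<^sub>m k"
proof -
  let ?B = "power_sum_mat k A"
  have B: "?B \<in> carrier_mat k k"
    by (simp add: power_sum_mat_def)
  have P: "A ^\<^sub>m n \<in> carrier_mat k k" for n
    by (rule pow_carrier_mat[OF A(1)])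
  have tele: "?B $$ (i, j) - (\<Sum>n<k. (A ^\<^sub>m Suc n) $$ (i, j)) = 1\<^sub>m k $$ (i, j)"
    if "i < k" "j < k" for i j
  proof -
    have "?B $$ (i, j) - (\<Sum>n<k. (A ^\<^sub>m Suc n) $$ (i, j)) =
        (A ^\<^sub>m 0) $$ (i, j) - (A ^\<^sub>m k) $$ (i, j)"
      using that sum_lessThan_telescope'[of "\<lambda>n. (A ^\<^sub>m n) $$ (i, j)" k]
      by (simp add: power_sum_mat_def sum_subtractf del: pow_mat.simps)
    then show ?thesis
      using that pow_mat_strictly_upper_triangular[OF A, of i j k] A by simp
  qed
  have AB: "(A * ?B) $$ (i, j) = (\<Sum>n<k. (A ^\<^sub>m Suc n) $$ (i, j))" if "i < k" "j < k" for i j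
  proof -
    have "(A * ?B) $$ (i, j) = (\<Sum>l<k. \<Sum>n<k. A $$ (i, l) * (A ^\<^sub>m n) $$ (l, j))"
      using that A B
      by (simp add: scalar_prod_def power_sum_mat_def sum_distrib_left atLeast0LessThan)
    also have "\<dots> = (\<Sum>n<k. (A ^\<^sub>m Suc n) $$ (i, j))"
      unfolding pow_mat_Suc_left[OF A(1)] using that A P
      by (subst sum.swap) (auto simp: scalar_prod_def atLeast0LessThan intro!: sum.cong)
    finally show ?thesis .
  qed
  have BA: "(?B * A) $$ (i, j) = (\<Sum>n<k. (A ^\<^sub>m Suc n) $$ (i, j))" if "i < k" "j < k" for i j
  proof -
    have "(?B * A) $$ (i, j) = (\<Sum>l<k. \<Sum>n<k. (A ^\<^sub>m n) $$ (i, l) * A $$ (l, j))"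
      using that A B
      by (simp add: scalar_prod_def power_sum_mat_def sum_distrib_right atLeast0LessThan)
    also have "\<dots> = (\<Sum>n<k. (A ^\<^sub>m Suc n) $$ (i, j))"
      using that A P
      by (subst sum.swap) (auto simp: scalar_prod_def atLeast0LessThan intro!: sum.cong)
    finally show ?thesis .
  qed
  have "(1\<^sub>m k - A) * ?B = ?B - A * ?B"
    using A B minus_mult_distrib_mat[of "1\<^sub>m k" k k A ?B k] by simp
  also have "\<dots> = 1\<^sub>m k"
    using A B tele AB by (intro eq_matI) auto
  finally show "(1\<^sub>m k - A) * ?B = 1\<^sub>m k" .
  have "?B * (1\<^sub>m k - A) = ?B - ?B * A"
    using A B mult_minus_distrib_mat[of ?B k k "1\<^sub>m k" k A] by simp
  also have "\<dots> = 1\<^sub>m k"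
    using A B tele BA by (intro eq_matI) auto
  finally show "?B * (1\<^sub>m k - A) = 1\<^sub>m k" .
qed

section \<open>The bijection\<close>

text \<open>The terms with \<open>j \<le> i\<close> vanish, so the inequalities defining
  \<open>P_seqs\<close> say that \<open>(1\<^sub>m k - A) *\<^sub>v v\<close> is
  nonnegative.\<close>

lemma one_minus_mult_vec_index:
  fixes A :: "'a :: ring_1 mat"
  assumes "A \<in> carrier_mat k k" "strictly_upper_triangular A" "v \<in> carrier_vec k" "i < k"
  shows "((1\<^sub>m k - A) *\<^sub>v v) $ i = v $ i - (\<Sum>j\<in>{i<..<k}. A $$ (i, j) * v $ j)"
proof -
  have "(\<Sum>j\<in>{..<k}. A $$ (i, j) * v $ j) = (\<Sum>j\<in>{i<..<k}. A $$ (i, j) * v $ j)"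
    using assms by (intro sum.mono_neutral_right) (auto simp: strictly_upper_triangular_def)
  moreover have "((1\<^sub>m k - A) *\<^sub>v v) $ i = v $ i - (\<Sum>j<k. A $$ (i, j) * v $ j)"
    using assms minus_mult_distrib_mat_vec[of "1\<^sub>m k" k k A v]
    by (simp add: scalar_prod_def atLeast0LessThan)
  ultimately show ?thesis by simp
qed

text \<open>Swapping the sums turns a statistic of the image into a weighted sum; with
  \<open>p\<close> as \<open>even\<close> or \<open>odd\<close> the weights are the column sums
  behind \<open>o_exp\<close> and \<open>e_exp\<close>.\<close>

lemma sum_mult_mat_vec:
  assumes "B \<in> carrier_mat k k"
  shows "(\<Sum>i | i < k \<and> p i. (B *\<^sub>v vec k f) $ i) =
    (\<Sum>j<k. (\<Sum>i | i < k \<and> p i. B $$ (i, j)) * (f j :: 'a :: semiring_0))"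
proof -
  have "(\<Sum>i | i < k \<and> p i. (B *\<^sub>v vec k f) $ i) =
      (\<Sum>i | i < k \<and> p i. \<Sum>j<k. B $$ (i, j) * f j)"
    using assms by (intro sum.cong) (auto simp: scalar_prod_def atLeast0LessThan)
  then show ?thesis
    by (subst (asm) sum.swap) (simp add: sum_distrib_right)
qed

lemma bij_betw_weighted_solutions_Q_seqs:
  fixes A B :: "int mat"
  assumes A: "A \<in> carrier_mat k k" "strictly_upper_triangular A"
    and B_def: "B = power_sum_mat k A"
    and nonneg: "\<forall>i<k. \<forall>j<k. B $$ (i, j) \<ge> 0"
  shows "bij_betw (\<lambda>f. B *\<^sub>v vec k (int \<circ> f))
    (weighted_solutions {..<k} (o_exp B) (e_exp B) l m) (Q_seqs A l m k)"
\<comment> \<open>On \<open>Q_seqs\<close> the argument of \<open>nat\<close> is nonnegative, so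
  nothing is truncated; the value 0 from \<open>k\<close> on meets the support condition.\<close>
proof (rule bij_betwI[where g = "\<lambda>v i. if i < k then nat (((1\<^sub>m k - A) *\<^sub>v v) $ i) else 0"])
  let ?F = "\<lambda>f. B *\<^sub>v vec k (int \<circ> f)"
  let ?D = "1\<^sub>m k - A"
  let ?g = "\<lambda>v i. if i < k then nat ((?D *\<^sub>v v) $ i) else 0"
  let ?W = "weighted_solutions {..<k} (o_exp B) (e_exp B) l m"
  have B: "B \<in> carrier_mat k k"
    by (simp add: B_def power_sum_mat_def)
  have D: "?D \<in> carrier_mat k k"
    by (rule minus_carrier_mat[OF A(1)])
  have DB: "?D *\<^sub>v (B *\<^sub>v v) = v" and BD: "B *\<^sub>v (?D *\<^sub>v v) = v" if "v \<in> carrier_vec k" for v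
    using that B D one_minus_mult_power_sum_mat[OF A] power_sum_mat_mult_one_minus[OF A]
    by (simp_all flip: assoc_mult_mat_vec add: B_def)
  have P_iff: "v \<in> P_seqs k A \<longleftrightarrow> v \<in> carrier_vec k \<and> (\<forall>i<k. (?D *\<^sub>v v) $ i \<ge> 0)" for v
    using one_minus_mult_vec_index[OF A] by (auto simp: P_seqs_def)
  have o: "(\<Sum>i | i < k \<and> even i. ?F f $ i) = int (\<Sum>i<k. o_exp B i * f i)" for f
    unfolding sum_mult_mat_vec[OF B] using B nonneg
    by (auto simp: o_exp_def intro!: sum.cong sum_nonneg)
  have e: "(\<Sum>i | i < k \<and> odd i. ?F f $ i) = int (\<Sum>i<k. e_exp B i * f i)" for f
    unfolding sum_mult_mat_vec[OF B] using B nonneg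
    by (auto simp: e_exp_def intro!: sum.cong sum_nonneg)
  \<comment> \<open>Membership in \<open>P_seqs\<close> is automatic: \<open>?D\<close> sends
    \<open>?F f\<close> back to \<open>vec k (int \<circ> f)\<close>, which is nonnegative.\<close>
  have Q_iff: "?F f \<in> Q_seqs A l m k \<longleftrightarrow>
      (\<Sum>i<k. o_exp B i * f i) = l \<and> (\<Sum>i<k. e_exp B i * f i) = m" for f
    unfolding Q_seqs_def mem_Collect_eq P_iff o e of_nat_eq_iff using B DB by simp
  have Fg: "?F (?g v) = v" if v: "v \<in> Q_seqs A l m k" for v
  proof -
    have P: "v \<in> carrier_vec k" "\<forall>i<k. (?D *\<^sub>v v) $ i \<ge> 0"
      using v P_iff by (auto simp: Q_seqs_def)
    then have "vec k (int \<circ> ?g v) = ?D *\<^sub>v v"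
      using D by (intro eq_vecI) (auto simp del: index_mult_mat_vec)
    then show ?thesis
      using P BD by simp
  qed
  show "?F \<in> ?W \<rightarrow> Q_seqs A l m k"
    unfolding Pi_iff Q_iff by (simp add: weighted_solutions_def)
  show "?g \<in> Q_seqs A l m k \<rightarrow> ?W"
  proof
    fix v assume v: "v \<in> Q_seqs A l m k"
    then have "?F (?g v) \<in> Q_seqs A l m k"
      using Fg by simp
    then show "?g v \<in> ?W"
      unfolding Q_iff by (simp add: weighted_solutions_def)
  qed
  show "?g (?F f) = f" if "f \<in> ?W" for f
    using that DB by (auto simp: weighted_solutions_def fun_eq_iff)
  show "?F (?g v) = v" if "v \<in> Q_seqs A l m k" for v
    using that by (rule Fg)
qed

text \<open>The diagonal entry 1 of \<open>B\<close> in column \<open>i\<close> is counted by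
  \<open>o_exp\<close> or \<open>e_exp\<close> according to the parity of \<open>i\<close>.
  Positivity yields both finiteness and invertible denominators.\<close>

lemma o_exp_plus_e_exp_pos:
  fixes A B :: "int mat"
  assumes A: "A \<in> carrier_mat k k" "strictly_upper_triangular A"
    and B_def: "B = power_sum_mat k A"
    and nonneg: "\<forall>i<k. \<forall>j<k. B $$ (i, j) \<ge> 0"
    and i: "i < k"
  shows "o_exp B i + e_exp B i > 0"
proof -
  have "(A ^\<^sub>m n) $$ (i, i) = (if n = 0 then 1 else 0)" for n
    using i A pow_mat_strictly_upper_triangular[OF A, of i i n] by auto
  then have "B $$ (i, i) = (\<Sum>n<k. if n = 0 then 1 else 0)"
    using i unfolding B_def power_sum_mat_def by simp
  then have diag: "B $$ (i, i) = 1"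
    using i by simp
  have B: "dim_row B = k"
    by (simp add: B_def power_sum_mat_def)
  have "B $$ (i, i) \<le> (\<Sum>j | j < dim_row B \<and> p j. B $$ (j, i))" if "p i" for p
    using i B nonneg that by (intro member_le_sum) auto
  from this[of even] this[of odd] show ?thesis
    using diag by (cases "even i") (auto simp: o_exp_def e_exp_def)
qed

theorem theorem3:
  fixes k :: nat and A B :: "int mat"
  assumes "k \<ge> 1"
    and "A \<in> carrier_mat k k"
    and "strictly_upper_triangular A"
    and "B = power_sum_mat k A"
    and "\<forall>i<k. \<forall>j<k. B $$ (i, j) \<ge> 0"
  shows "(\<forall>l m. finite (Q_seqs A l m k)) \<and>
    bivariate_gf (\<lambda>l m. of_nat (card (Q_seqs A l m k))) =
      (\<Prod>i<k. 1 / (1 - x_var ^ o_exp B i * y_var ^ e_exp B i))"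
proof -
  let ?W = "weighted_solutions {..<k} (o_exp B) (e_exp B)"
  have bij: "bij_betw (\<lambda>f. B *\<^sub>v vec k (int \<circ> f)) (?W l m) (Q_seqs A l m k)" for l m
    using assms(2-5) by (rule bij_betw_weighted_solutions_Q_seqs)
  have pos: "o_exp B i + e_exp B i > 0" if "i \<in> {..<k}" for i
    using o_exp_plus_e_exp_pos[OF assms(2-5)] that by simp
  \<comment> \<open>As \<open>card\<close> is 0 on infinite sets, finiteness is what makes the
    coefficients genuine counts.\<close>
  have "finite (Q_seqs A l m k)" for l m
    using bij_betw_finite[OF bij] finite_weighted_solutions[of "{..<k}", OF _ pos] by simp
  moreover have "card (Q_seqs A l m k) = card (?W l m)" for l m
    using bij_betw_same_card[OF bij] by simp
  ultimately show ?thesis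
    using bivariate_gf_weighted_solutions[of "{..<k}", OF _ pos] by simp
qed

end
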